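(* Let $f:\mathbb{R}^s\times\mathbb{R}^n\to\mathbb{R}$ and $\mathbf{g}=(g_1,\dots,g_m)^\top:\mathbb{R}^s\times\mathbb{R}^n\to\mathbb{R}^m$ be convex and continuously differentiable, and consider the parametric convex problem $V(\mathbf{x})=\min_{\mathbf{z}}\{f(\mathbf{z},\mathbf{x}) : \mathbf{g}(\mathbf{z},\mathbf{x})\le \mathbf{0}_m\}$ with feasible parameter set $\mathcal{X}$. Assume that $\mathcal{X}$ is full-dimensional in $\mathbb{R}^n$, that for every $\mathbf{x}\in\mathcal{X}$ the value $V(\mathbf{x})$ is finite and the minimum is attained, and that strong duality $V(\mathbf{x})=V_{\mathrm{D}}(\mathbf{x})$ holds for every $\mathbf{x}\in\mathcal{X}$. Let $\mathbf{z}^*:\mathcal{X}\to\mathbb{R}^s$ be a primal optimizer function and $\boldsymbol{\lambda}^*:\mathcal{X}\to\mathbb{R}^m$ a dual optimizer function such that (i) $\mathbf{z}^*$ and $\boldsymbol{\lambda}^*$ are continuous on $\mathrm{int}(\mathcal{X})$, and (ii) $\mathbf{z}^*$ and $\boldsymbol{\lambda}^*$ are continuously differentiable on $\mathrm{int}(\mathcal{R}(\mathcal{E}))$ for all $\mathcal{E}\in\mathbb{A}$, i.e. for every active set $\mathcal{E}$ whose critical region $\mathcal{R}(\mathcal{E})$ is full-dimensional. Then for all $\mathbf{x}\in\mathrm{int}(\mathcal{X})$ the gradient of the value function is given by $$\nabla_{\mathbf{x}}V(\mathbf{x})=\left[\frac{\partial f}{\partial \mathbf{x}}(\mathbf{z}^*(\mathbf{x}),\mathbf{x})\right]^\top+\left[\frac{\partial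 \mathbf{g}}{\partial \mathbf{x}}(\mathbf{z}^*(\mathbf{x}),\mathbf{x})\right]^\top\boldsymbol{\lambda}^*(\mathbf{x}).$$ Furthermore, $\nabla_{\mathbf{x}}V$ is a continuous function on $\mathrm{int}(\mathcal{X})$.
   Context: Convexity of $f$ and of each component $g_i$ is joint in $(\mathbf{z},\mathbf{x})$; vector inequalities are componentwise. The set of feasible parameters is $\mathcal{X}=\{\mathbf{x}\in\mathbb{R}^n : \exists\,\mathbf{z}\in\mathbb{R}^s,\ \mathbf{g}(\mathbf{z},\mathbf{x})\le\mathbf{0}_m\}$. A subset of $\mathbb{R}^n$ is full-dimensional if it has nonempty interior. A primal optimizer function is any function $\mathbf{z}^*:\mathcal{X}\to\mathbb{R}^s$ such that, for each $\mathbf{x}\in\mathcal{X}$, $\mathbf{z}^*(\mathbf{x})$ is feasible ($\mathbf{g}(\mathbf{z}^*(\mathbf{x}),\mathbf{x})\le\mathbf{0}_m$) and $f(\mathbf{z}^*(\mathbf{x}),\mathbf{x})=V(\mathbf{x})$; it chooses one minimizer for each $\mathbf{x}$, and minimizers need not be unique. The dual problem is $V_{\mathrm{D}}(\mathbf{x})=\max_{\boldsymbol{\lambda}\ge\mathbf{0}_m}\inf_{\mathbf{z}\in\mathbb{R}^s}L(\mathbf{z},\boldsymbol{\lambda},\mathbf{x})$ with Lagrangian $L(\mathbf{z},\boldsymbol{\lambda},\mathbf{x})=f(\mathbf{z},\mathbf{x})+\boldsymbol{\lambda}^\top\mathbf{g}(\mathbf{z},\mathbf{x})$. Strong duality at $\mathbf{x}$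 means $V(\mathbf{x})=V_{\mathrm{D}}(\mathbf{x})$, with the maximum in the dual attained. A dual optimizer function $\boldsymbol{\lambda}^*:\mathcal{X}\to\mathbb{R}^m$ chooses one maximizer $\boldsymbol{\lambda}^*(\mathbf{x})\ge\mathbf{0}_m$ of the dual problem for each $\mathbf{x}\in\mathcal{X}$. For $\mathbf{x}\in\mathcal{X}$ the active set (with respect to the chosen $\mathbf{z}^*$) is $\mathcal{A}(\mathbf{x})=\{i\in\{1,\dots,m\} : g_i(\mathbf{z}^*(\mathbf{x}),\mathbf{x})=0\}$. A set $\mathcal{E}\subseteq\{1,\dots,m\}$ is an active set of the problem if $\mathcal{E}=\mathcal{A}(\bar{\mathbf{x}})$ for some $\bar{\mathbf{x}}\in\mathcal{X}$; its critical region is $\mathcal{R}(\mathcal{E})=\{\mathbf{x}\in\mathcal{X} : \mathcal{A}(\mathbf{x})=\mathcal{E}\}$. $\mathbb{A}$ denotes the collection of all active sets $\mathcal{E}$ for which $\mathcal{R}(\mathcal{E})$ is full-dimensional. $\frac{\partial f}{\partial\mathbf{x}}$ (a row vector in $\mathbb{R}^{1\times n}$) and $\frac{\partial\mathbf{g}}{\partial\mathbf{x}}$ (an $m\times n$ matrix) denote partial Jacobians with respect to the second argument $\mathbf{x}$, with $\mathbf{z}$ held fixed, evaluated at $(\mathbf{z}^*(\mathbf{x}),\mathbf{x})$. The gradient $\nabla_{\mathbf{x}}V$ is a column vector; the claim includes that $V$ is differentiable at every point of $\mathrm{int}(\mathcal{X})$. *)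

theory Defs
  imports "HOL-Analysis.Analysis"
begin

text \<open>Intended for open sets \<open>S\<close>: the derivative is the full one, \<open>at x\<close>.\<close>

definition continuously_differentiable_on ::
  "'a::real_normed_vector set \<Rightarrow> ('a \<Rightarrow> 'b::real_normed_vector) \<Rightarrow> bool" where
  "continuously_differentiable_on S h \<longleftrightarrow>
     (\<exists>h' :: 'a \<Rightarrow> 'a \<Rightarrow>\<^sub>L 'b.
        (\<forall>x\<in>S. (h has_derivative blinfun_apply (h' x)) (at x)) \<and> continuous_on S h')"

definition full_dimensional :: "'a::topological_space set \<Rightarrow> bool" where
  "full_dimensional S \<longleftrightarrow> interior S \<noteq> {}"

definition gradient :: "('a::real_inner \<Rightarrow> real) \<Rightarrow> 'a \<Rightarrow> 'a" where
  "gradient h x = (THE D. GDERIV h x :> D)"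

lemma gradient_eqI:
  assumes "GDERIV h x :> D"
  shows "gradient h x = D"
  unfolding gradient_def
proof (rule the_equality)
  fix D' assume "GDERIV h x :> D'"
  then have "(\<lambda>v. v \<bullet> D') = (\<lambda>v. v \<bullet> D)"
    using assms has_derivative_unique unfolding gderiv_def by blast
  then have "v \<bullet> D' = v \<bullet> D" for v
    by meson
  then show "D' = D"
    by (metis inner_diff_right inner_eq_zero_iff right_minus_eq)
qed (fact assms)

text \<open>A real-valued function \<open>f\<close> is passed as \<open>\<lambda>p. vec (f p) :: real^1\<close>, which makes its
  partial Jacobian a 1-by-n matrix.\<close>

definition partial_jacobian_x ::
  "((real^'s) \<times> (real^'n) \<Rightarrow> real^'m) \<Rightarrow> real^'s \<Rightarrow> real^'n \<Rightarrow> real^'n^'m" where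
  "partial_jacobian_x h z x = jacobian (\<lambda>y. h (z, y)) (at x)"

text \<open>In the following the order on \<open>real^'m\<close> is the componentwise one of the library.\<close>

definition feasible_points ::
  "((real^'s) \<times> (real^'n) \<Rightarrow> real^'m) \<Rightarrow> real^'n \<Rightarrow> (real^'s) set" where
  "feasible_points g x = {z. g (z, x) \<le> 0}"

definition feasible_params :: "((real^'s) \<times> (real^'n) \<Rightarrow> real^'m) \<Rightarrow> (real^'n) set" where
  "feasible_params g = {x. \<exists>z. g (z, x) \<le> 0}"

text \<open>The optimal values are extended reals: the dual function may take the value \<open>-\<infinity>\<close>, and the
  primal value is \<open>\<infinity>\<close> at infeasible parameters. For real-valued infima, unbounded sets
  would give unspecified values.\<close>

definition primal_value ::
  "((real^'s) \<times> (real^'n) \<Rightarrow> real) \<Rightarrow> ((real^'s) \<times> (real^'n) \<Rightarrow> real^'m) \<Rightarrow> real^'n \<Rightarrow> ereal" where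
  "primal_value f g x = (INF z\<in>feasible_points g x. ereal (f (z, x)))"

definition lagrangian ::
  "((real^'s) \<times> (real^'n) \<Rightarrow> real) \<Rightarrow> ((real^'s) \<times> (real^'n) \<Rightarrow> real^'m)
     \<Rightarrow> real^'s \<Rightarrow> real^'m \<Rightarrow> real^'n \<Rightarrow> real" where
  "lagrangian f g z l x = f (z, x) + l \<bullet> g (z, x)"

definition dual_function ::
  "((real^'s) \<times> (real^'n) \<Rightarrow> real) \<Rightarrow> ((real^'s) \<times> (real^'n) \<Rightarrow> real^'m)
     \<Rightarrow> real^'m \<Rightarrow> real^'n \<Rightarrow> ereal" where
  "dual_function f g l x = (INF z. ereal (lagrangian f g z l x))"

definition dual_value ::
  "((real^'s) \<times> (real^'n) \<Rightarrow> real) \<Rightarrow> ((real^'s) \<times> (real^'n) \<Rightarrow> real^'m) \<Rightarrow> real^'n \<Rightarrow> ereal" where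
  "dual_value f g x = (SUP l\<in>{l. 0 \<le> l}. dual_function f g l x)"

definition strong_duality ::
  "((real^'s) \<times> (real^'n) \<Rightarrow> real) \<Rightarrow> ((real^'s) \<times> (real^'n) \<Rightarrow> real^'m) \<Rightarrow> real^'n \<Rightarrow> bool" where
  "strong_duality f g x \<longleftrightarrow>
     primal_value f g x = dual_value f g x \<and>
     (\<exists>l. 0 \<le> l \<and> dual_function f g l x = dual_value f g x)"

text \<open>Optimizer functions are total functions whose values matter only on \<open>feasible_params g\<close>.\<close>

definition primal_optimizer ::
  "((real^'s) \<times> (real^'n) \<Rightarrow> real) \<Rightarrow> ((real^'s) \<times> (real^'n) \<Rightarrow> real^'m)
     \<Rightarrow> (real^'n \<Rightarrow> real^'s) \<Rightarrow> bool" where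
  "primal_optimizer f g zs \<longleftrightarrow>
     (\<forall>x\<in>feasible_params g. g (zs x, x) \<le> 0 \<and> ereal (f (zs x, x)) = primal_value f g x)"

definition dual_optimizer ::
  "((real^'s) \<times> (real^'n) \<Rightarrow> real) \<Rightarrow> ((real^'s) \<times> (real^'n) \<Rightarrow> real^'m)
     \<Rightarrow> (real^'n \<Rightarrow> real^'m) \<Rightarrow> bool" where
  "dual_optimizer f g ls \<longleftrightarrow>
     (\<forall>x\<in>feasible_params g. 0 \<le> ls x \<and> dual_function f g (ls x) x = dual_value f g x)"

definition active_set ::
  "((real^'s) \<times> (real^'n) \<Rightarrow> real^'m) \<Rightarrow> (real^'n \<Rightarrow> real^'s) \<Rightarrow> real^'n \<Rightarrow> 'm set" where
  "active_set g zs x = {i. g (zs x, x) $ i = 0}"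

definition critical_region ::
  "((real^'s) \<times> (real^'n) \<Rightarrow> real^'m) \<Rightarrow> (real^'n \<Rightarrow> real^'s) \<Rightarrow> 'm set \<Rightarrow> (real^'n) set" where
  "critical_region g zs E = {x \<in> feasible_params g. active_set g zs x = E}"

definition full_dim_active_sets ::
  "((real^'s) \<times> (real^'n) \<Rightarrow> real^'m) \<Rightarrow> (real^'n \<Rightarrow> real^'s) \<Rightarrow> 'm set set" where
  "full_dim_active_sets g zs =
     {E. (\<exists>x\<in>feasible_params g. E = active_set g zs x) \<and> full_dimensional (critical_region g zs E)}"

end

theory Submission
  imports Defs
begin

text \<open>The pair of optimizers is a saddle point of the Lagrangian \<open>L\<close>. Comparing the saddle
  inequalities at two parameters \<open>x\<close> and \<open>y\<close> bounds \<open>V y - V x\<close> above by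
  \<open>L (z* x) (l* y) y - L (z* x) (l* y) x\<close>, which is differentiable in \<open>y\<close> at \<open>x\<close> although \<open>l*\<close> is
  merely continuous, because \<open>l*\<close> only multiplies the increment of \<open>g\<close>. Below, \<open>V y - V x\<close> dominates
  its linear part: \<open>L\<close> is jointly convex in \<open>(z, x)\<close> for fixed multiplier and its
  derivative in \<open>z\<close> vanishes at the optimizer. Both bounds have the same derivative.\<close>

text \<open>The lower bound makes the first-order remainder of \<open>W\<close> nonnegative and the
  upper bound keeps it below the remainder of \<open>h\<close>, which is
  o(\<open>norm (y - x)\<close>).\<close>

lemma has_derivative_sandwich:
  fixes W h :: "'a::real_normed_vector \<Rightarrow> real"
  assumes h: "(h has_derivative D) (at x)"
    and lower: "\<forall>\<^sub>F y in at x. D (y - x) \<le> W y - W x"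
    and upper: "\<forall>\<^sub>F y in at x. W y - W x \<le> h y - h x"
  shows "(W has_derivative D) (at x)"
  unfolding has_derivative_iff_norm
proof
  show "bounded_linear D"
    using h by (rule has_derivative_bounded_linear)
  show "((\<lambda>y. norm (W y - W x - D (y - x)) / norm (y - x)) \<longlongrightarrow> 0) (at x)"
  proof (rule Lim_null_comparison)
    show "((\<lambda>y. norm (h y - h x - D (y - x)) / norm (y - x)) \<longlongrightarrow> 0) (at x)"
      using h by (simp add: has_derivative_iff_norm)
    show "\<forall>\<^sub>F y in at x. norm (norm (W y - W x - D (y - x)) / norm (y - x))
        \<le> norm (h y - h x - D (y - x)) / norm (y - x)"
      using lower upper by eventually_elim (auto intro!: divide_right_mono)
  qed
qed

text \<open>In the product rule the variation of \<open>l\<close> is multiplied by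
  \<open>G x = 0\<close>, so continuity of \<open>l\<close> replaces differentiability. This is what
  admits a multiplier function known only to be continuous.\<close>

lemma has_derivative_inner_vanishing:
  fixes G :: "'a::real_normed_vector \<Rightarrow> 'b::real_inner"
  assumes G: "(G has_derivative G') (at x)" and "G x = 0" and l: "isCont l x"
  shows "((\<lambda>y. l y \<bullet> G y) has_derivative (\<lambda>v. l x \<bullet> G' v)) (at x)"
  unfolding has_derivative_iff_norm
proof
  have bl: "bounded_linear G'"
    using G by (rule has_derivative_bounded_linear)
  then show "bounded_linear (\<lambda>v. l x \<bullet> G' v)"
    by (rule bounded_linear_inner_right[THEN bounded_linear_compose])
  obtain K where K: "\<And>v. norm (G' v) \<le> norm v * K"
    using bl bounded_linear.bounded by blast
  let ?r = "\<lambda>y. norm (G y - G x - G' (y - x)) / norm (y - x)"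
  show "((\<lambda>y. norm (l y \<bullet> G y - l x \<bullet> G x - l x \<bullet> G' (y - x)) / norm (y - x)) \<longlongrightarrow> 0) (at x)"
  proof (rule Lim_null_comparison)
    \<comment> \<open>Adding and subtracting \<open>l y \<bullet> G' (y - x)\<close> splits the
      remainder: \<open>l y\<close> times the remainder of \<open>G\<close>, plus the variation of
      \<open>l\<close> times \<open>G' (y - x)\<close>, where \<open>K\<close> bounds
      \<open>G'\<close>.\<close>
    have "((\<lambda>y. norm (l y) * ?r y + norm (l y - l x) * K)
        \<longlongrightarrow> norm (l x) * 0 + norm (l x - l x) * K) (at x)"
      using G l by (intro tendsto_intros) (auto simp: has_derivative_iff_norm isCont_def)
    then show "((\<lambda>y. norm (l y) * ?r y + norm (l y - l x) * K) \<longlongrightarrow> 0) (at x)"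
      by simp
    show "\<forall>\<^sub>F y in at x. norm (norm (l y \<bullet> G y - l x \<bullet> G x - l x \<bullet> G' (y - x)) / norm (y - x))
        \<le> norm (l y) * ?r y + norm (l y - l x) * K"
    proof (rule eventually_mono[OF eventually_neq_at_within])
      fix y assume "y \<noteq> x"
      then have pos: "0 < norm (y - x)" by simp
      have "norm (l y \<bullet> G y - l x \<bullet> G x - l x \<bullet> G' (y - x))
          = norm (l y \<bullet> (G y - G x - G' (y - x)) + (l y - l x) \<bullet> G' (y - x))"
        using \<open>G x = 0\<close> by (simp add: algebra_simps)
      also have "\<dots> \<le> norm (l y) * norm (G y - G x - G' (y - x)) + norm (l y - l x) * norm (G' (y - x))"
        by (rule norm_triangle_mono) (simp_all add: Cauchy_Schwarz_ineq2)
      also have "\<dots> \<le> norm (l y) * norm (G y - G x - G' (y - x)) + norm (l y - l x) * (norm (y - x) * K)"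
        by (intro add_left_mono mult_left_mono K) simp
      finally show "norm (norm (l y \<bullet> G y - l x \<bullet> G x - l x \<bullet> G' (y - x)) / norm (y - x))
        \<le> norm (l y) * ?r y + norm (l y - l x) * K"
        using pos by (simp add: field_simps)
    qed
  qed
qed

text \<open>Restriction to the line through \<open>p\<close> and \<open>q\<close> reduces this to
  the tangent inequality for a convex function of one real variable, compared at parameters 0 and
  1.\<close>

lemma convex_on_imp_above_derivative:
  fixes F :: "'a::real_normed_vector \<Rightarrow> real"
  assumes F: "convex_on UNIV F" and D: "(F has_derivative D) (at p)"
  shows "D (q - p) \<le> F q - F p"
proof -
  let ?c = "\<lambda>t. p + t *\<^sub>R (q - p)"
  have "convex_on UNIV (\<lambda>t. F (?c t))"
  proof (rule convex_onI)
    fix t s u :: real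
    assume "0 < t" "t < 1"
    moreover have "?c ((1 - t) *\<^sub>R s + t *\<^sub>R u) = (1 - t) *\<^sub>R ?c s + t *\<^sub>R ?c u"
      by (simp add: algebra_simps)
    ultimately show "F (?c ((1 - t) *\<^sub>R s + t *\<^sub>R u)) \<le> (1 - t) * F (?c s) + t * F (?c u)"
      using convex_onD[OF F, of t "?c s" "?c u"] by simp
  qed simp
  moreover have "((\<lambda>t. F (?c t)) has_field_derivative D (q - p)) (at 0)"
  proof -
    have "(?c has_derivative (\<lambda>t. t *\<^sub>R (q - p))) (at 0)"
      by (auto intro!: derivative_eq_intros)
    moreover have "(F has_derivative D) (at (?c 0))"
      using D by simp
    ultimately have "((\<lambda>t. F (?c t)) has_derivative (\<lambda>t. D (t *\<^sub>R (q - p)))) (at 0)"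
      by (rule has_derivative_compose)
    moreover have "D (t *\<^sub>R (q - p)) = D (q - p) * t" for t
      using linear_scale[OF has_derivative_linear[OF D]] by (simp add: mult.commute)
    ultimately show ?thesis
      by (simp add: has_field_derivative_def)
  qed
  ultimately show ?thesis
    using convex_on_imp_above_tangent[of UNIV "\<lambda>t. F (?c t)" 0 1 "D (q - p)"] by simp
qed

lemma inner_nonneg_nonpos:
  fixes a b :: "real^'m"
  assumes "0 \<le> a" "b \<le> 0"
  shows "a \<bullet> b \<le> 0"
  using assms by (auto simp: inner_vec_def less_eq_vec_def intro!: sum_nonpos mult_nonneg_nonpos)

lemma convex_on_finite_sum:
  assumes "finite I" "convex S" "\<And>i. i \<in> I \<Longrightarrow> convex_on S (h i)"
  shows "convex_on S (\<lambda>p. \<Sum>i\<in>I. h i p)"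
  using assms by (induction I rule: finite_induct) (auto intro: convex_on_add simp: convex_on_const)

lemma convex_on_lagrangian:
  assumes "convex_on UNIV f" "\<And>i. convex_on UNIV (\<lambda>p. g p $ i)" "0 \<le> l"
  shows "convex_on UNIV (\<lambda>p. f p + l \<bullet> g p)"
  using assms unfolding inner_vec_def
  by (auto intro!: convex_on_add convex_on_finite_sum convex_on_cmul simp: less_eq_vec_def)

text \<open>By strong duality the dual function at \<open>ls x\<close> equals the primal minimum,
  hence bounds it by the Lagrangian at every \<open>z\<close>. Taking \<open>z = zs x\<close> gives
  \<open>0 \<le> ls x \<bullet> g (zs x, x)\<close>, while the sign conditions give the reverse:
  complementary slackness.\<close>

lemma lagrangian_saddle_point:
  assumes "x \<in> feasible_params g" "strong_duality f g x"
    and "primal_optimizer f g zs" "dual_optimizer f g ls"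
  shows "ls x \<bullet> g (zs x, x) = 0" "f (zs x, x) \<le> f (z, x) + ls x \<bullet> g (z, x)"
proof -
  have min: "f (zs x, x) \<le> f (z, x) + ls x \<bullet> g (z, x)" for z
  proof -
    have "ereal (f (zs x, x)) = dual_function f g (ls x) x"
      using assms by (simp add: strong_duality_def primal_optimizer_def dual_optimizer_def)
    also have "\<dots> \<le> ereal (f (z, x) + ls x \<bullet> g (z, x))"
      unfolding dual_function_def lagrangian_def by (rule INF_lower) simp
    finally show ?thesis by simp
  qed
  then show "f (zs x, x) \<le> f (z, x) + ls x \<bullet> g (z, x)" .
  have "ls x \<bullet> g (zs x, x) \<le> 0"
    using assms by (intro inner_nonneg_nonpos) (auto simp: primal_optimizer_def dual_optimizer_def)
  then show "ls x \<bullet> g (zs x, x) = 0"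
    using min[of "zs x"] by simp
qed

lemma has_derivative_partial_snd:
  assumes "(h has_derivative h') (at (z, x))"
  shows "((\<lambda>y. h (z, y)) has_derivative (\<lambda>v. h' (0, v))) (at x)"
proof -
  have "((\<lambda>y. (z, y)) has_derivative (\<lambda>v. (0, v))) (at x)"
    by (auto intro!: derivative_eq_intros)
  then show ?thesis
    by (rule has_derivative_compose) (rule assms)
qed

lemma has_derivative_partial_fst:
  assumes "(h has_derivative h') (at (z, x))"
  shows "((\<lambda>w. h (w, x)) has_derivative (\<lambda>v. h' (v, 0))) (at z)"
proof -
  have "((\<lambda>w. (w, x)) has_derivative (\<lambda>v. (v, 0))) (at z)"
    by (auto intro!: derivative_eq_intros)
  then show ?thesis
    by (rule has_derivative_compose) (rule assms)
qed

lemma partial_jacobian_x_mult: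
  fixes h :: "(real^'s) \<times> (real^'n) \<Rightarrow> real^'m"
  assumes "(h has_derivative h') (at (z, x))"
  shows "partial_jacobian_x h z x *v v = h' (0, v)"
proof -
  have "((\<lambda>y. h (z, y)) has_derivative (\<lambda>v. h' (0, v))) (at x)"
    using assms by (rule has_derivative_partial_snd)
  moreover from this have "((\<lambda>y. h (z, y)) has_derivative (*v) (partial_jacobian_x h z x)) (at x)"
    unfolding partial_jacobian_x_def using jacobian_works differentiableI by blast
  ultimately show ?thesis
    using has_derivative_unique by metis
qed

text \<open>Tested against a direction \<open>v\<close>, the matrix formula becomes the x-derivative
  of the Lagrangian with \<open>z\<close> and \<open>l\<close> frozen. The main proof can thus work
  with Frechet derivatives instead of Jacobians.\<close>

lemma inner_lagrangian_gradient:
  fixes f :: "(real^'s) \<times> (real^'n) \<Rightarrow> real" and g :: "(real^'s) \<times> (real^'n) \<Rightarrow> real^'m"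
  assumes f: "(f has_derivative f') (at (z, x))" and g: "(g has_derivative g') (at (z, x))"
  shows "v \<bullet> (column 1 (transpose (partial_jacobian_x (\<lambda>p. vec (f p) :: real^1) z x))
      + transpose (partial_jacobian_x g z x) *v l) = f' (0, v) + l \<bullet> g' (0, v)"
proof -
  have "((\<lambda>p. vec (f p) :: real^1) has_derivative (\<lambda>q. vec (f' q))) (at (z, x))"
    using f by (rule bounded_linear.has_derivative[OF linear_conv_bounded_linear[THEN iffD1, OF linear_vec]])
  from partial_jacobian_x_mult[OF this, of v]
  have "v \<bullet> row 1 (partial_jacobian_x (\<lambda>p. vec (f p) :: real^1) z x) = f' (0, v)"
    by (simp add: vec_eq_iff matrix_vector_mul_component row_def inner_commute)
  moreover have "v \<bullet> (transpose (partial_jacobian_x g z x) *v l) = l \<bullet> g' (0, v)"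
    by (metis dot_lmul_matrix inner_commute partial_jacobian_x_mult[OF g] transpose_matrix_vector)
  ultimately show ?thesis
    by (simp add: inner_add_right)
qed

theorem theorem2:
  fixes f :: "(real^'s) \<times> (real^'n) \<Rightarrow> real"
    and g :: "(real^'s) \<times> (real^'n) \<Rightarrow> real^'m"
    and zs :: "real^'n \<Rightarrow> real^'s"
    and ls :: "real^'n \<Rightarrow> real^'m"
  assumes "convex_on UNIV f"
    and "\<And>i. convex_on UNIV (\<lambda>p. g p $ i)"
    and "continuously_differentiable_on UNIV f"
    and "continuously_differentiable_on UNIV g"
    and "full_dimensional (feasible_params g)"
    and "\<And>x. x \<in> feasible_params g \<Longrightarrow> \<bar>primal_value f g x\<bar> \<noteq> \<infinity>"
    and "\<And>x. x \<in> feasible_params g \<Longrightarrow>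
           \<exists>z\<in>feasible_points g x. ereal (f (z, x)) = primal_value f g x"
    and "\<And>x. x \<in> feasible_params g \<Longrightarrow> strong_duality f g x"
    and "primal_optimizer f g zs"
    and "dual_optimizer f g ls"
    and "continuous_on (interior (feasible_params g)) zs"
    and "continuous_on (interior (feasible_params g)) ls"
    and "\<And>E. E \<in> full_dim_active_sets g zs \<Longrightarrow>
           continuously_differentiable_on (interior (critical_region g zs E)) zs"
    and "\<And>E. E \<in> full_dim_active_sets g zs \<Longrightarrow>
           continuously_differentiable_on (interior (critical_region g zs E)) ls"
  shows "(\<forall>x\<in>interior (feasible_params g).
            (\<lambda>y. real_of_ereal (primal_value f g y)) differentiable (at x) \<and>
            gradient (\<lambda>y. real_of_ereal (primal_value f g y)) x =
              column 1 (transpose (partial_jacobian_x (\<lambda>p. vec (f p) :: real^1) (zs x) x))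
              + transpose (partial_jacobian_x g (zs x) x) *v ls x) \<and>
         continuous_on (interior (feasible_params g))
           (gradient (\<lambda>y. real_of_ereal (primal_value f g y)))"
proof -
  let ?X = "feasible_params g"
  let ?V = "\<lambda>y. real_of_ereal (primal_value f g y)"
  let ?q = "\<lambda>x. column 1 (transpose (partial_jacobian_x (\<lambda>p. vec (f p) :: real^1) (zs x) x))
      + transpose (partial_jacobian_x g (zs x) x) *v ls x"
  obtain f' where f': "\<And>p. (f has_derivative blinfun_apply (f' p)) (at p)"
      and cf': "continuous_on UNIV f'"
    using assms(3) unfolding continuously_differentiable_on_def by blast
  obtain g' where g': "\<And>p. (g has_derivative blinfun_apply (g' p)) (at p)"
      and cg': "continuous_on UNIV g'"
    using assms(4) unfolding continuously_differentiable_on_def by blast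
  \<comment> \<open>At a feasible parameter the extended value is the \<open>ereal\<close> of a real
    number, so \<open>real_of_ereal\<close> loses nothing there.\<close>
  have V: "?V x = f (zs x, x)" and feas: "g (zs x, x) \<le> 0" and nonneg: "0 \<le> ls x"
    if "x \<in> ?X" for x
    using assms(9,10) that unfolding primal_optimizer_def dual_optimizer_def
    by (metis real_of_ereal.simps(1))+
  have slack: "ls x \<bullet> g (zs x, x) = 0"
    and min: "f (zs x, x) \<le> f (z, x) + ls x \<bullet> g (z, x)" if "x \<in> ?X" for x z
    using lagrangian_saddle_point[OF that assms(8)[OF that] assms(9,10)] by auto
  have q: "v \<bullet> ?q x = f' (zs x, x) (0, v) + ls x \<bullet> g' (zs x, x) (0, v)" for v x
    using f' g' by (rule inner_lagrangian_gradient)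

  have lower: "(y - x) \<bullet> ?q x \<le> ?V y - ?V x" if "x \<in> ?X" "y \<in> ?X" for x y
  proof -
    let ?F = "\<lambda>p. f p + ls x \<bullet> g p"
    let ?F' = "\<lambda>v. f' (zs x, x) v + ls x \<bullet> g' (zs x, x) v"
    have F': "(?F has_derivative ?F') (at (zs x, x))"
      by (intro has_derivative_add has_derivative_inner_right f' g')
    \<comment> \<open>By slackness \<open>?F (zs x, x)\<close> is \<open>f (zs x, x)\<close>, so the
      saddle inequality says that \<open>zs x\<close> minimizes \<open>?F\<close> in its first
      argument: stationarity in \<open>z\<close>.\<close>
    have "(\<lambda>v. ?F' (v, 0)) = (\<lambda>v. 0)"
      using has_derivative_partial_fst[OF F'] slack[OF that(1)] min[OF that(1)]
      by (intro has_derivative_local_min) auto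
    then have z0: "?F' (zs y - zs x, 0) = 0"
      by meson
    have "?F' ((zs y, y) - (zs x, x)) = ?F' (zs y - zs x, 0) + ?F' (0, y - x)"
      using linear_add[OF has_derivative_linear[OF F'], of "(zs y - zs x, 0)" "(0, y - x)"] by simp
    then have "?F' (0, y - x) = ?F' ((zs y, y) - (zs x, x))"
      using z0 by linarith
    with q have "(y - x) \<bullet> ?q x = ?F' ((zs y, y) - (zs x, x))"
      by (rule trans)
    also have "\<dots> \<le> ?F (zs y, y) - ?F (zs x, x)"
      using convex_on_lagrangian[OF assms(1,2) nonneg[OF that(1)]] F'
      by (rule convex_on_imp_above_derivative)
    \<comment> \<open>At \<open>(zs y, y)\<close> the multiplier term is nonpositive by feasibility;
      at \<open>(zs x, x)\<close> it is zero by slackness.\<close>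
    also have "\<dots> \<le> ?V y - ?V x"
      using inner_nonneg_nonpos[OF nonneg feas, OF that] slack[OF that(1)] that by (simp add: V)
    finally show ?thesis .
  qed

  have deriv: "GDERIV ?V x :> ?q x" if x: "x \<in> interior ?X" for x
  proof -
    \<comment> \<open>The saddle bound with \<open>z\<close> frozen at \<open>zs x\<close>.
      Subtracting \<open>g (zs x, x)\<close> makes the factor of \<open>ls y\<close> vanish at
      \<open>y = x\<close>, as \<open>has_derivative_inner_vanishing\<close> requires.\<close>
    let ?h = "\<lambda>y. f (zs x, y) + ls y \<bullet> (g (zs x, y) - g (zs x, x))"
    have xX: "x \<in> ?X" using x interior_subset by blast
    \<comment> \<open>Infeasible parameters, where \<open>real_of_ereal\<close> sends the value
      \<infinity> to 0, stay away from an interior point and cannot affect the derivative.\<close>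
    have ev: "\<forall>\<^sub>F y in at x. y \<in> ?X"
      using eventually_at_in_open'[OF open_interior x] interior_subset
      by (auto elim!: eventually_mono)
    have "isCont ls x"
      using assms(12) x by (simp add: continuous_on_eq_continuous_at)
    moreover have "((\<lambda>y. g (zs x, y) - g (zs x, x)) has_derivative
        (\<lambda>v. g' (zs x, x) (0, v) - 0)) (at x)"
      by (rule has_derivative_diff[OF has_derivative_partial_snd[OF g'] has_derivative_const])
    ultimately have "((\<lambda>y. ls y \<bullet> (g (zs x, y) - g (zs x, x))) has_derivative
        (\<lambda>v. ls x \<bullet> g' (zs x, x) (0, v))) (at x)"
      using has_derivative_inner_vanishing by fastforce
    then have "(?h has_derivative (\<lambda>v. v \<bullet> ?q x)) (at x)"
      unfolding q by (rule has_derivative_add[OF has_derivative_partial_snd[OF f']])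
    moreover have "\<forall>\<^sub>F y in at x. (y - x) \<bullet> ?q x \<le> ?V y - ?V x"
      using ev lower[OF xX] by (rule eventually_mono)
    moreover have "\<forall>\<^sub>F y in at x. ?V y - ?V x \<le> ?h y - ?h x"
      using ev
    proof (rule eventually_mono)
      fix y assume y: "y \<in> ?X"
      \<comment> \<open>The saddle inequality at \<open>y\<close>, tried at the point
        \<open>zs x\<close>, bounds \<open>?V y\<close>; removing
        \<open>ls y \<bullet> g (zs x, x)\<close>, which is nonpositive, only enlarges the bound.
        Moreover \<open>?h x = ?V x\<close>.\<close>
      show "?V y - ?V x \<le> ?h y - ?h x"
        using min[OF y, of "zs x"] inner_nonneg_nonpos[OF nonneg[OF y] feas[OF xX]]
        by (simp add: V y xX inner_diff_right)
    qed
    ultimately show ?thesis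
      unfolding gderiv_def by (rule has_derivative_sandwich)
  qed
  then have grad: "gradient ?V x = ?q x" if "x \<in> interior ?X" for x
    using that by (intro gradient_eqI)

  have "continuous_on (interior ?X) ?q"
  \<comment> \<open>Pairing with a fixed \<open>v\<close> lets \<open>q\<close> express
    \<open>?q\<close> through the operator-valued derivatives \<open>f'\<close> and
    \<open>g'\<close>, which are continuous and are composed here with the continuous
    optimizers.\<close>
  proof (rule continuous_on_componentwise[THEN iffD2, OF ballI])
    fix v :: "real^'n"
    have "continuous_on (interior ?X) (\<lambda>x. (zs x, x))"
      using assms(11) by (intro continuous_intros)
    then have "continuous_on (interior ?X) (\<lambda>x. f' (zs x, x))"
        "continuous_on (interior ?X) (\<lambda>x. g' (zs x, x))"
      by (auto intro: continuous_on_compose2[OF cf'] continuous_on_compose2[OF cg'])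
    then have "continuous_on (interior ?X) (\<lambda>x. v \<bullet> ?q x)"
      unfolding q using assms(12) by (intro continuous_intros)
    then show "continuous_on (interior ?X) (\<lambda>x. ?q x \<bullet> v)"
      by (simp only: inner_commute)
  qed
  then have "continuous_on (interior ?X) (gradient ?V)"
    using grad by (subst continuous_on_cong) auto
  moreover have "?V differentiable (at x)" if "x \<in> interior ?X" for x
    using deriv[OF that] unfolding gderiv_def by (rule differentiableI)
  ultimately show ?thesis
    using grad by simp
qed

end
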